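(* Let $f:\mathbb{R}^{n_\phi}\to\mathbb{R}^p$ and $g:\mathbb{R}^{n_\phi}\to\mathbb{R}$ have bounded gain, let $\mathcal{S}\subset\mathbb{R}^{p\times d_y}$ be a bounded set, and let $c_0\ge0$, $\epsilon>0$. Suppose that a controller $(g_1,g_2,h,\mathcal{X})$ of the form described in the context provides a convolution bound for $(f,s(\mathcal{S},c_0,\epsilon))$ with gain $c_1\ge1$ and decay rate $\lambda_1\in(0,1)$. Then for every $\beta\in(0,1)$ and every $\lambda_2\in(\max\{\lambda_1,\beta\},1)$ there exist $\bar\mu>0$ and $c_2>0$ such that for every $\theta^*\in s(\mathcal{S},c_0,\epsilon)$, $\mu\in(0,\bar\mu)$, $t_0\in\mathbb{Z}$, $\phi_0\in\mathbb{R}^{n_\phi}$, $z_{1_0}\in\mathbb{R}^{l_1}$, $z_{2_0}\in\mathcal{X}$, $m_0\in\mathbb{R}$, $r\in\mathbb{S}(\mathbb{R}^q)$ and $w\in\mathbb{S}(\mathbb{R}^{d_y})$, when the controller is applied to the plant $$y(t+1)=\theta^*(t)^\top f(\phi(t))+w(t)+d_\Delta(t),\quad t\ge t_0,\qquad \phi(t_0)=\phi_0,$$ where $d_\Delta(t)\in\mathbb{R}^{d_y}$ is any signal satisfying $$m(t+1)=\beta m(t)+\beta|g(\phi(t))|,\quad m(t_0)=m_0,\qquad \|d_\Delta(t)\|\le\mu m(t)+\mu|g(\phi(t))|,\qquad t\ge t_0,$$ the following holds for all $t\ge t_0$: $$\left\|\begin{bmatrix} \phi(t) \\ z_1(t)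 \\ m(t) \end{bmatrix}\right\|\le c_2\lambda_2^{t-t_0}\left\|\begin{bmatrix} \phi_0 \\ z_{1_0} \\ m_0 \end{bmatrix}\right\|+\sum_{j=t_0}^{t-1}c_2\lambda_2^{t-j-1}(\|r(j)\|+\|w(j)\|)+c_2\|r(t)\|.$$
   Context: Notation. $\|\cdot\|$ is the Euclidean norm of a vector and the corresponding induced norm of a matrix. $\mathbb{S}(\mathbb{R}^{k})$ is the set of all $\mathbb{R}^{k}$-valued sequences (indexed by $\mathbb{Z}$), and $\boldsymbol\ell_\infty(\mathbb{R}^{p\times d_y})$ is the set of bounded $\mathbb{R}^{p\times d_y}$-valued sequences indexed by $\mathbb{Z}$. A function $\Gamma:\mathbb{R}^a\to\mathbb{R}^b$ has a bounded gain if there is $\nu>0$ with $\|\Gamma(x)\|\le\nu\|x\|$ for all $x\in\mathbb{R}^a$. Plant. Fix dimensions $d_y,d_u,p,n_y,n_u\in\mathbb{N}$ and put $n_\phi=n_y d_y+n_u d_u$. With output $y(t)\in\mathbb{R}^{d_y}$, input $u(t)\in\mathbb{R}^{d_u}$ and disturbance $w(t)\in\mathbb{R}^{d_y}$, let $\phi(t)\in\mathbb{R}^{n_\phi}$ be the column vector obtained by stacking $y(t),y(t-1),\dots,y(t-n_y+1),u(t),u(t-1),\dots,u(t-n_u+1)$. For a parameter sequence $\theta^*(\cdot)$ the (nominal) time-varying plant is $$y(t+1)=\theta^*(t)^\top f(\phi(t))+w(t),\quad t\ge t_0,\qquad \phi(t_0)=\phi_0.$$ Controller. Fix integers $l_1,l_2,q\ge0$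 and a set $\mathcal{X}\subset\mathbb{R}^{l_2}$. The controller has states $z_1(t)\in\mathbb{R}^{l_1}$, $z_2(t)\in\mathbb{R}^{l_2}$ and an exogenous signal $r(t)\in\mathbb{R}^q$, and is given for $t\ge t_0$ by $$z_1(t+1)=g_1(z_1(t),z_2(t),\phi(t),y(t+1),r(t),t,t_0),\quad z_1(t_0)=z_{1_0},$$ $$z_2(t+1)=g_2(z_1(t),z_2(t),\phi(t),y(t+1),r(t),t,t_0),\quad z_2(t_0)=z_{2_0},$$ $$u(t)=h(z_1(t),z_2(t),\phi(t),r(t)),$$ where $g_1$ is $\mathbb{R}^{l_1}$-valued, $h$ is $\mathbb{R}^{d_u}$-valued, and $g_2:\mathbb{R}^{l_1}\times\mathcal{X}\times\mathbb{R}^{n_\phi}\times\mathbb{R}^{d_y}\times\mathbb{R}^q\times\mathbb{Z}\times\mathbb{Z}\to\mathcal{X}$ (so $z_2$ stays in $\mathcal{X}$ if $z_{2_0}\in\mathcal{X}$). Applying the controller to a plant means that $y,u,z_1,z_2$ satisfy the plant and controller equations simultaneously for all $t\ge t_0$. Time-variation class. For $c_0\ge0$, $\epsilon>0$, $s(\mathcal{S},c_0,\epsilon)$ is the set of $\theta^*\in\boldsymbol\ell_\infty(\mathbb{R}^{p\times d_y})$ such that $\theta^*(t)\in\mathcal{S}$ for all $t\in\mathbb{Z}$ and $\sum_{t=t_1}^{t_2-1}\|\theta^*(t+1)-\theta^*(t)\|\le c_0+\epsilon(t_2-t_1)$ for all integers $t_2>t_1$. Convolution bound for $(f,s(\mathcal{S},c_0,\epsilon))$.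 The controller provides a convolution bound for $(f,s(\mathcal{S},c_0,\epsilon))$ with gain $c\ge1$ and decay rate $\lambda\in(0,1)$ if for every $\theta^*\in s(\mathcal{S},c_0,\epsilon)$, $t_0\in\mathbb{Z}$, $\phi_0\in\mathbb{R}^{n_\phi}$, $z_{1_0}\in\mathbb{R}^{l_1}$, $z_{2_0}\in\mathcal{X}$, $w\in\mathbb{S}(\mathbb{R}^{d_y})$ and $r\in\mathbb{S}(\mathbb{R}^q)$, when the controller is applied to the nominal time-varying plant with parameter sequence $\theta^*(\cdot)$, for all integers $t\ge\tau\ge t_0$: $$\left\|\begin{bmatrix} \phi(t) \\ z_1(t) \end{bmatrix}\right\|\le c\lambda^{t-\tau}\left\|\begin{bmatrix} \phi(\tau) \\ z_1(\tau) \end{bmatrix}\right\|+\sum_{j=\tau}^{t-1}c\lambda^{t-j-1}(\|r(j)\|+\|w(j)\|)+c\|r(t)\|.$$ *)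

theory Defs
  imports "HOL-Analysis.L2_Norm" "Jordan_Normal_Form.Matrix"
begin

text \<open>
  All dimensions are natural numbers, possibly \<open>0\<close>: \<open>\<real>\<^sup>n\<close> is \<open>carrier_vec n\<close> and
  \<open>\<real>\<^sup>m\<^sup>\<times>\<^sup>n\<close> is \<open>carrier_mat m n\<close>.
\<close>

definition vnorm :: "real vec \<Rightarrow> real" where
  "vnorm v = L2_set (\<lambda>i. v $ i) {..<dim_vec v}"

definition mnorm :: "real mat \<Rightarrow> real" where
  "mnorm A = (SUP x \<in> {x \<in> carrier_vec (dim_col A). vnorm x \<le> 1}. vnorm (A *\<^sub>v x))"

definition seqs :: "nat \<Rightarrow> (int \<Rightarrow> real vec) set" where
  "seqs k = {x. \<forall>t. x t \<in> carrier_vec k}"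

definition bounded_mat_seqs :: "nat \<Rightarrow> nat \<Rightarrow> (int \<Rightarrow> real mat) set" where
  "bounded_mat_seqs p dy =
     {\<theta>. (\<forall>t. \<theta> t \<in> carrier_mat p dy) \<and> (\<exists>B. \<forall>t. mnorm (\<theta> t) \<le> B)}"

definition bounded_mat_set :: "real mat set \<Rightarrow> bool" where
  "bounded_mat_set S \<longleftrightarrow> (\<exists>B. \<forall>A\<in>S. mnorm A \<le> B)"

text \<open>The parameter \<open>N\<close> is the norm of the codomain (\<open>vnorm\<close>, or \<open>abs\<close> for scalar functions).\<close>

definition bounded_gain :: "nat \<Rightarrow> ('b \<Rightarrow> real) \<Rightarrow> (real vec \<Rightarrow> 'b) \<Rightarrow> bool" where
  "bounded_gain a N \<Gamma> \<longleftrightarrow> (\<exists>\<nu>>0. \<forall>x\<in>carrier_vec a. N (\<Gamma> x) \<le> \<nu> * vnorm x)"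

definition slow_class ::
  "nat \<Rightarrow> nat \<Rightarrow> real mat set \<Rightarrow> real \<Rightarrow> real \<Rightarrow> (int \<Rightarrow> real mat) set" where
  "slow_class p dy S c0 \<epsilon> =
     {\<theta> \<in> bounded_mat_seqs p dy.
        (\<forall>t. \<theta> t \<in> S) \<and>
        (\<forall>t1 t2. t1 < t2 \<longrightarrow>
           (\<Sum>t=t1..t2 - 1. mnorm (\<theta> (t + 1) - \<theta> t)) \<le> c0 + \<epsilon> * real_of_int (t2 - t1))}"

text \<open>\<open>stack n x t\<close> is the column of \<open>x t, x (t - 1), \<dots>, x (t - n + 1)\<close>.\<close>

fun stack :: "nat \<Rightarrow> (int \<Rightarrow> real vec) \<Rightarrow> int \<Rightarrow> real vec" where
  "stack 0 x t = vNil"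
| "stack (Suc n) x t = x t @\<^sub>v stack n x (t - 1)"

definition regressor ::
  "nat \<Rightarrow> nat \<Rightarrow> (int \<Rightarrow> real vec) \<Rightarrow> (int \<Rightarrow> real vec) \<Rightarrow> int \<Rightarrow> real vec" where
  "regressor ny nu y u t = stack ny y t @\<^sub>v stack nu u t"

text \<open>Arguments of \<open>ctl_g1\<close> and \<open>ctl_g2\<close>, in order: \<open>z\<^sub>1(t), z\<^sub>2(t), \<phi>(t), y(t+1), r(t), t, t\<^sub>0\<close>;
  of \<open>ctl_h\<close>: \<open>z\<^sub>1(t), z\<^sub>2(t), \<phi>(t), r(t)\<close>.\<close>

record controller =
  ctl_g1 :: "real vec \<Rightarrow> real vec \<Rightarrow> real vec \<Rightarrow> real vec \<Rightarrow> real vec \<Rightarrow> int \<Rightarrow> int \<Rightarrow> real vec"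
  ctl_g2 :: "real vec \<Rightarrow> real vec \<Rightarrow> real vec \<Rightarrow> real vec \<Rightarrow> real vec \<Rightarrow> int \<Rightarrow> int \<Rightarrow> real vec"
  ctl_h :: "real vec \<Rightarrow> real vec \<Rightarrow> real vec \<Rightarrow> real vec \<Rightarrow> real vec"
  ctl_X :: "real vec set"

definition is_controller ::
  "nat \<Rightarrow> nat \<Rightarrow> nat \<Rightarrow> nat \<Rightarrow> nat \<Rightarrow> nat \<Rightarrow> controller \<Rightarrow> bool" where
  "is_controller nphi dy du l1 l2 q K \<longleftrightarrow>
     ctl_X K \<subseteq> carrier_vec l2 \<and>
     (\<forall>z1\<in>carrier_vec l1. \<forall>z2\<in>ctl_X K. \<forall>\<phi>\<in>carrier_vec nphi. \<forall>r\<in>carrier_vec q.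
        ctl_h K z1 z2 \<phi> r \<in> carrier_vec du \<and>
        (\<forall>y\<in>carrier_vec dy. \<forall>t t0.
           ctl_g1 K z1 z2 \<phi> y r t t0 \<in> carrier_vec l1 \<and>
           ctl_g2 K z1 z2 \<phi> y r t t0 \<in> ctl_X K))"

definition plant_eqs ::
  "nat \<Rightarrow> nat \<Rightarrow> (real vec \<Rightarrow> real vec) \<Rightarrow> (int \<Rightarrow> real mat) \<Rightarrow> (int \<Rightarrow> real vec) \<Rightarrow>
   int \<Rightarrow> real vec \<Rightarrow> (int \<Rightarrow> real vec) \<Rightarrow> (int \<Rightarrow> real vec) \<Rightarrow> bool" where
  "plant_eqs ny nu f \<theta> w t0 \<phi>0 y u \<longleftrightarrow>
     regressor ny nu y u t0 = \<phi>0 \<and>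
     (\<forall>t\<ge>t0. y (t + 1) = transpose_mat (\<theta> t) *\<^sub>v f (regressor ny nu y u t) + w t)"

definition perturbed_plant_eqs ::
  "nat \<Rightarrow> nat \<Rightarrow> (real vec \<Rightarrow> real vec) \<Rightarrow> (int \<Rightarrow> real mat) \<Rightarrow> (int \<Rightarrow> real vec) \<Rightarrow>
   (int \<Rightarrow> real vec) \<Rightarrow> int \<Rightarrow> real vec \<Rightarrow> (int \<Rightarrow> real vec) \<Rightarrow> (int \<Rightarrow> real vec) \<Rightarrow> bool" where
  "perturbed_plant_eqs ny nu f \<theta> w d\<^sub>\<Delta> t0 \<phi>0 y u \<longleftrightarrow>
     regressor ny nu y u t0 = \<phi>0 \<and>
     (\<forall>t\<ge>t0. y (t + 1) = transpose_mat (\<theta> t) *\<^sub>v f (regressor ny nu y u t) + w t + d\<^sub>\<Delta> t)"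

text \<open>
  Since \<open>regressor ny nu y u t\<close> contains \<open>u t\<close> when \<open>nu > 0\<close>, the equation for \<open>u t\<close> is
  implicit. The closed loop is therefore a relation between signals, and no existence or
  uniqueness of trajectories is presupposed.
\<close>

definition controller_eqs ::
  "nat \<Rightarrow> nat \<Rightarrow> controller \<Rightarrow> int \<Rightarrow> real vec \<Rightarrow> real vec \<Rightarrow> (int \<Rightarrow> real vec) \<Rightarrow>
   (int \<Rightarrow> real vec) \<Rightarrow> (int \<Rightarrow> real vec) \<Rightarrow> (int \<Rightarrow> real vec) \<Rightarrow> (int \<Rightarrow> real vec) \<Rightarrow> bool" where
  "controller_eqs ny nu K t0 z10 z20 r y u z1 z2 \<longleftrightarrow>
     z1 t0 = z10 \<and> z2 t0 = z20 \<and>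
     (\<forall>t\<ge>t0.
        z1 (t + 1) = ctl_g1 K (z1 t) (z2 t) (regressor ny nu y u t) (y (t + 1)) (r t) t t0 \<and>
        z2 (t + 1) = ctl_g2 K (z1 t) (z2 t) (regressor ny nu y u t) (y (t + 1)) (r t) t t0 \<and>
        u t = ctl_h K (z1 t) (z2 t) (regressor ny nu y u t) (r t))"

definition convolution_bound ::
  "nat \<Rightarrow> nat \<Rightarrow> nat \<Rightarrow> nat \<Rightarrow> nat \<Rightarrow> nat \<Rightarrow> controller \<Rightarrow> (real vec \<Rightarrow> real vec) \<Rightarrow>
   (int \<Rightarrow> real mat) set \<Rightarrow> real \<Rightarrow> real \<Rightarrow> bool" where
  "convolution_bound ny nu dy du l1 q K f \<Theta> c lam \<longleftrightarrow>
     c \<ge> 1 \<and> 0 < lam \<and> lam < 1 \<and>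
     (\<forall>\<theta>\<in>\<Theta>. \<forall>t0. \<forall>\<phi>0\<in>carrier_vec (ny * dy + nu * du).
      \<forall>z10\<in>carrier_vec l1. \<forall>z20\<in>ctl_X K. \<forall>w\<in>seqs dy. \<forall>r\<in>seqs q.
      \<forall>y\<in>seqs dy. \<forall>u\<in>seqs du. \<forall>z1 z2.
        plant_eqs ny nu f \<theta> w t0 \<phi>0 y u \<and> controller_eqs ny nu K t0 z10 z20 r y u z1 z2 \<longrightarrow>
        (\<forall>\<tau> t. t0 \<le> \<tau> \<and> \<tau> \<le> t \<longrightarrow>
           vnorm (regressor ny nu y u t @\<^sub>v z1 t)
           \<le> c * lam powi (t - \<tau>) * vnorm (regressor ny nu y u \<tau> @\<^sub>v z1 \<tau>)
             + (\<Sum>j=\<tau>..t - 1. c * lam powi (t - j - 1) * (vnorm (r j) + vnorm (w j)))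
             + c * vnorm (r t)))"

end

theory Submission
  imports Defs
begin

text \<open>
  A trajectory of the perturbed closed loop is a trajectory of the nominal one with disturbance
  \<open>w + d\<^sub>\<Delta>\<close>, so the convolution bound applies to it. Up to the feedthrough term \<open>c\<^sub>1 \<parallel>r(t)\<parallel>\<close>, that
  bound is the solution \<open>v\<close> of a scalar first-order recursion with pole \<open>\<lambda>\<^sub>1\<close> driven by
  \<open>\<parallel>r\<parallel> + \<parallel>w\<parallel> + \<parallel>d\<^sub>\<Delta>\<parallel>\<close>. For \<open>\<kappa> = (\<lambda>\<^sub>2 - \<lambda>\<^sub>1) / (2 \<beta> \<nu>)\<close>, with \<open>\<nu>\<close> a gain of \<open>g\<close>, and small \<open>\<mu>\<close> the
  function \<open>V = v + \<kappa> \<bar>m\<bar>\<close> satisfies \<open>V(t+1) \<le> \<lambda>\<^sub>2 V(t) + 2 c\<^sub>1 (\<parallel>r(t)\<parallel> + \<parallel>w(t)\<parallel>)\<close>.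
\<close>

section \<open>Euclidean norm of vectors and of stacked blocks\<close>

lemma vnorm_nonneg [simp]: "0 \<le> vnorm v"
  by (simp add: vnorm_def)

lemma vnorm_add_le:
  assumes "v \<in> carrier_vec n" "w \<in> carrier_vec n"
  shows "vnorm (v + w) \<le> vnorm v + vnorm w"
proof -
  have "vnorm (v + w) = L2_set (\<lambda>i. v $ i + w $ i) {..<n}"
    using assms unfolding vnorm_def by (intro L2_set_cong) auto
  also have "\<dots> \<le> vnorm v + vnorm w"
    using assms L2_set_triangle_ineq[of "\<lambda>i. v $ i" "\<lambda>i. w $ i" "{..<n}"] by (simp add: vnorm_def)
  finally show ?thesis .
qed

lemma vnorm_append: "vnorm (v @\<^sub>v w) = sqrt ((vnorm v)\<^sup>2 + (vnorm w)\<^sup>2)"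
proof -
  let ?n = "dim_vec v" and ?k = "dim_vec w"
  have "(\<Sum>i<n + k. h i) = (\<Sum>i<n. h i) + (\<Sum>i<k. h (n + i))"
    for h :: "nat \<Rightarrow> real" and n k
    by (induction k) (simp_all add: add.assoc)
  then have "(\<Sum>i<?n + ?k. ((v @\<^sub>v w) $ i)\<^sup>2)
      = (\<Sum>i<?n. ((v @\<^sub>v w) $ i)\<^sup>2) + (\<Sum>i<?k. ((v @\<^sub>v w) $ (?n + i))\<^sup>2)" .
  also have "\<dots> = (\<Sum>i<?n. (v $ i)\<^sup>2) + (\<Sum>i<?k. (w $ i)\<^sup>2)"
    by simp
  finally show ?thesis
    by (simp add: vnorm_def L2_set_def sum_nonneg)
qed

lemma vnorm_le_append_left: "vnorm v \<le> vnorm (v @\<^sub>v w)"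
  by (simp add: vnorm_append real_le_rsqrt)

lemma vnorm_le_append_right: "vnorm w \<le> vnorm (v @\<^sub>v w)"
  by (simp add: vnorm_append real_le_rsqrt)

text \<open>Serves to regroup the stacked vector of \<open>\<phi>\<close>, \<open>z1\<close> and
  \<open>m\<close> as a pair whose first block is the one measured by the convolution bound.\<close>

lemma append_vec_assoc: "(u @\<^sub>v v) @\<^sub>v w = u @\<^sub>v v @\<^sub>v w"
  by (rule eq_vecI) auto

lemma vnorm_append_le: "vnorm (v @\<^sub>v w) \<le> vnorm v + vnorm w"
  by (simp add: vnorm_append sqrt_sum_squares_le_sum)

lemma vnorm_singleton [simp]: "vnorm (vCons a vNil) = \<bar>a\<bar>"
  by (simp add: vnorm_def L2_set_def)

section \<open>Dimensions of the regressor\<close>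

lemma stack_carrier: "x \<in> seqs k \<Longrightarrow> stack n x t \<in> carrier_vec (n * k)"
proof (induction n arbitrary: t)
  case (Suc n)
  then have "x t \<in> carrier_vec k" "stack n x (t - 1) \<in> carrier_vec (n * k)"
    by (auto simp: seqs_def)
  then show ?case by (auto intro: append_carrier_vec)
qed simp

lemma regressor_carrier:
  "y \<in> seqs dy \<Longrightarrow> u \<in> seqs du \<Longrightarrow> regressor ny nu y u t \<in> carrier_vec (ny * dy + nu * du)"
  by (simp add: regressor_def append_carrier_vec stack_carrier)

section \<open>Scalar first-order recursions\<close>

text \<open>The zero-state response of the scalar filter with pole \<open>lam\<close> and input
  \<open>b\<close>, started at \<open>t0\<close>. The sum ends at \<open>t - 1\<close>, so it is
  empty at \<open>t = t0\<close> and the input at time \<open>t\<close> first acts at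
  \<open>t + 1\<close>.\<close>

definition filtered :: "real \<Rightarrow> (int \<Rightarrow> real) \<Rightarrow> int \<Rightarrow> int \<Rightarrow> real" where
  "filtered lam b t0 t = (\<Sum>j=t0..t - 1. lam powi (t - j - 1) * b j)"

lemma filtered_start [simp]: "filtered lam b t0 t0 = 0"
  by (simp add: filtered_def)

lemma filtered_step:
  assumes "lam \<noteq> 0" "t0 \<le> t"
  shows "filtered lam b t0 (t + 1) = lam * filtered lam b t0 t + b t"
proof -
  have "{t0..t} = insert t {t0..t - 1}"
    using assms by auto
  then have "filtered lam b t0 (t + 1) = b t + (\<Sum>j=t0..t - 1. lam powi (t - j) * b j)"
    by (simp add: filtered_def)
  also have "(\<Sum>j=t0..t - 1. lam powi (t - j) * b j) = lam * filtered lam b t0 t"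
    unfolding filtered_def sum_distrib_left
    using assms by (intro sum.cong) (simp_all add: power_int_diff)
  finally show ?thesis by simp
qed

lemma filtered_mult: "filtered lam (\<lambda>j. c * b j) t0 t = c * filtered lam b t0 t"
  by (simp add: filtered_def sum_distrib_left mult_ac)

lemma filtered_nonneg: "0 \<le> lam \<Longrightarrow> (\<And>j. 0 \<le> b j) \<Longrightarrow> 0 \<le> filtered lam b t0 t"
  by (simp add: filtered_def sum_nonneg)

lemma filtered_mono:
  "0 \<le> lam \<Longrightarrow> (\<And>j. t0 \<le> j \<Longrightarrow> a j \<le> b j) \<Longrightarrow> filtered lam a t0 t \<le> filtered lam b t0 t"
  by (auto simp: filtered_def intro!: sum_mono mult_left_mono)

text \<open>A comparison principle: multiplication by \<open>lam > 0\<close> preserves the induction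
  hypothesis, and the right-hand side satisfies the recursion with equality.\<close>

lemma linear_recursion_le:
  fixes V :: "int \<Rightarrow> real"
  assumes lam: "0 < lam" and t: "t0 \<le> t"
    and step: "\<And>t. t0 \<le> t \<Longrightarrow> V (t + 1) \<le> lam * V t + b t"
  shows "V t \<le> lam powi (t - t0) * V t0 + filtered lam b t0 t"
  using t
proof (induction t rule: int_ge_induct)
  case (step t)
  have "V (t + 1) \<le> lam * V t + b t"
    using assms(3) step.hyps .
  also have "\<dots> \<le> lam * (lam powi (t - t0) * V t0 + filtered lam b t0 t) + b t"
    using lam step.IH by simp
  also have "\<dots> = lam powi (t + 1 - t0) * V t0 + filtered lam b t0 (t + 1)"
    unfolding filtered_step[OF less_imp_neq[OF lam, symmetric] step.hyps]
    using lam by (simp add: power_int_diff power_int_add algebra_simps)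
  finally show ?case .
qed simp

section \<open>Small-gain estimate for scalar signals\<close>

text \<open>The bound \<open>\<mu> \<le> \<kappa> * \<delta> / c\<close> keeps the coefficient of \<open>M\<close> in \<open>v + \<kappa> * M\<close> contracting.\<close>

lemma small_gain_bound:
  fixes x M d a \<rho> :: "int \<Rightarrow> real"
  assumes lam: "0 < lam1" "lam1 < lam2" "lam2 < 1" and \<beta>: "0 < \<beta>" "\<beta> < lam2"
    and c: "1 \<le> c" and \<nu>: "0 < \<nu>"
    and \<kappa>: "\<kappa> = (lam2 - lam1) / (2 * \<beta> * \<nu>)"
    and \<mu>: "0 < \<mu>" "\<mu> \<le> (lam2 - lam1) / (2 * c * \<nu>)" "\<mu> \<le> \<kappa> * (lam2 - \<beta>) / c"
    and M: "\<And>t. 0 \<le> M t" and a: "\<And>t. 0 \<le> \<rho> t" "\<And>t. \<rho> t \<le> a t"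
    and x_le: "\<And>t. t0 \<le> t \<Longrightarrow>
      x t \<le> c * lam1 powi (t - t0) * x0 + c * filtered lam1 (\<lambda>j. a j + d j) t0 t + c * \<rho> t"
    and M_le: "\<And>t. t0 \<le> t \<Longrightarrow> M (t + 1) \<le> \<beta> * M t + \<beta> * \<nu> * x t"
    and d_le: "\<And>t. t0 \<le> t \<Longrightarrow> d t \<le> \<mu> * M t + \<mu> * \<nu> * x t"
    and x0: "0 \<le> x0"
    and d: "\<And>t. 0 \<le> d t"
    and t: "t0 \<le> t"
  shows "x t + M t \<le> (1 + 1 / \<kappa>) *
    (lam2 powi (t - t0) * (c * x0 + \<kappa> * M t0) + 2 * c * filtered lam2 a t0 t) + c * \<rho> t"
proof -
  define v where "v t = c * lam1 powi (t - t0) * x0 + c * filtered lam1 (\<lambda>j. a j + d j) t0 t" for t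
  define V where "V t = v t + \<kappa> * M t" for t
  \<comment> \<open>The gap \<open>lam2 - lam1\<close> is split into halves. The choice of
    \<open>\<kappa>\<close> makes the influence of \<open>x\<close> through
    \<open>\<kappa> * M\<close> cost one half; \<open>c\<mu>\<nu>\<close> bounds its influence
    through \<open>d\<close> by the other.\<close>
  have \<kappa>_pos: "0 < \<kappa>" and \<kappa>\<beta>: "\<kappa> * (\<beta> * \<nu>) = (lam2 - lam1) / 2"
    using lam \<beta> \<nu> by (simp_all add: \<kappa>)
  have a0: "0 \<le> a t" for t
    using a order_trans by blast
  have v_nonneg: "0 \<le> v t" for t
    unfolding v_def using lam c x0 a0 d by (intro add_nonneg_nonneg mult_nonneg_nonneg filtered_nonneg) auto
  have c\<mu>\<nu>: "c * (\<mu> * \<nu>) \<le> (lam2 - lam1) / 2"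
    using \<mu>(2) c \<nu> by (simp add: field_simps)
  have c\<mu>: "c * \<mu> \<le> \<kappa> * (lam2 - \<beta>)"
    using \<mu>(3) c by (simp add: field_simps)
  have V_step: "V (t + 1) \<le> lam2 * V t + 2 * c * a t" if t: "t0 \<le> t" for t
  proof -
    have x: "x t \<le> v t + c * \<rho> t"
      using x_le[OF t] by (simp add: v_def)
    have "v (t + 1) = lam1 * v t + c * (a t + d t)"
      unfolding v_def filtered_step[OF less_imp_neq[OF lam(1), symmetric] t]
      using lam by (simp add: power_int_diff power_int_add algebra_simps)
    also have "\<dots> \<le> lam1 * v t + c * (a t + (\<mu> * M t + \<mu> * \<nu> * x t))"
      using d_le[OF t] c by simp
    finally have "V (t + 1) \<le> lam1 * v t + c * (a t + (\<mu> * M t + \<mu> * \<nu> * x t))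
        + \<kappa> * (\<beta> * M t + \<beta> * \<nu> * x t)"
      using mult_left_mono[OF M_le[OF t], of \<kappa>] \<kappa>_pos unfolding V_def by linarith
    also have "\<dots> = lam1 * v t + c * a t + (c * \<mu> + \<kappa> * \<beta>) * M t
        + (c * (\<mu> * \<nu>) + \<kappa> * (\<beta> * \<nu>)) * x t"
      by (simp add: algebra_simps)
    \<comment> \<open>The coefficient of \<open>x t\<close> is nonnegative, so \<open>x t\<close>
      may be replaced by its bound. The coefficient is at most \<open>lam2 - lam1\<close>, exactly
      what lifts the factor of \<open>v t\<close> from \<open>lam1\<close> to
      \<open>lam2\<close>.\<close>
    also have "\<dots> \<le> lam1 * v t + c * a t + \<kappa> * lam2 * M t + (lam2 - lam1) * (v t + c * \<rho> t)"
    proof -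
      have "(c * \<mu> + \<kappa> * \<beta>) * M t \<le> \<kappa> * lam2 * M t"
        using c\<mu> M by (intro mult_right_mono) (simp_all add: algebra_simps)
      moreover have "(c * (\<mu> * \<nu>) + \<kappa> * (\<beta> * \<nu>)) * x t
          \<le> (c * (\<mu> * \<nu>) + \<kappa> * (\<beta> * \<nu>)) * (v t + c * \<rho> t)"
        using x c \<mu> \<nu> \<kappa>_pos \<beta> by (intro mult_left_mono) auto
      moreover have "\<dots> \<le> (lam2 - lam1) * (v t + c * \<rho> t)"
        using c\<mu>\<nu> \<kappa>\<beta> v_nonneg[of t] a c by (intro mult_right_mono) auto
      ultimately show ?thesis by linarith
    qed
    \<comment> \<open>The feedthrough is absorbed into the input by
      \<open>lam2 - lam1 \<le> 1\<close> and \<open>\<rho> t \<le> a t\<close>; this second copy of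
      \<open>c * a t\<close> is the origin of the factor 2.\<close>
    also have "(lam2 - lam1) * (v t + c * \<rho> t) \<le> (lam2 - lam1) * v t + c * a t"
    proof -
      have "(lam2 - lam1) * (c * \<rho> t) \<le> 1 * (c * a t)"
        using lam c a by (intro mult_mono) auto
      then show ?thesis by (simp add: algebra_simps)
    qed
    finally show ?thesis
      by (simp add: V_def algebra_simps)
  qed
  have V_le: "V t \<le> lam2 powi (t - t0) * V t0 + 2 * c * filtered lam2 a t0 t"
    using linear_recursion_le[of lam2 t0 t V, OF _ t V_step] lam by (simp add: filtered_mult)
  have "x t + M t \<le> v t + M t + c * \<rho> t"
    using x_le[OF t] by (simp add: v_def)
  \<comment> \<open>Both \<open>v t \<le> V t\<close> and \<open>M t \<le> V t / \<kappa>\<close>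
    hold, since the two summands of \<open>V t\<close> are nonnegative.\<close>
  also have "v t + M t \<le> (1 + 1 / \<kappa>) * V t"
    using \<kappa>_pos v_nonneg[of t] M[of t] by (simp add: V_def field_simps)
  also have "\<dots> \<le> (1 + 1 / \<kappa>) *
      (lam2 powi (t - t0) * V t0 + 2 * c * filtered lam2 a t0 t)"
    using V_le \<kappa>_pos by (intro mult_left_mono) auto
  \<comment> \<open>The filtered sum vanishes at \<open>t0\<close>, so \<open>V t0\<close> is
    \<open>c * x0 + \<kappa> * M t0\<close>.\<close>
  finally show ?thesis
    by (simp add: V_def v_def)
qed

section \<open>Application to the perturbed closed loop\<close>

theorem theorem3:
  fixes dy du p ny nu l1 l2 q nphi :: nat
    and f :: "real vec \<Rightarrow> real vec" and g :: "real vec \<Rightarrow> real"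
    and S :: "real mat set" and K :: controller
    and c0 \<epsilon> c1 lam1 :: real
  assumes nphi: "nphi = ny * dy + nu * du"
    and f: "f \<in> carrier_vec nphi \<rightarrow> carrier_vec p" "bounded_gain nphi vnorm f"
    and g: "bounded_gain nphi abs g"
    and S: "S \<subseteq> carrier_mat p dy" "bounded_mat_set S"
    and "c0 \<ge> 0" and "\<epsilon> > 0"
    and K: "is_controller nphi dy du l1 l2 q K"
    and conv: "convolution_bound ny nu dy du l1 q K f (slow_class p dy S c0 \<epsilon>) c1 lam1"
  shows "\<forall>\<beta>\<in>{0<..<1}. \<forall>lam2\<in>{max lam1 \<beta><..<1}. \<exists>\<mu>bar>0. \<exists>c2>0.
    \<forall>\<theta>\<in>slow_class p dy S c0 \<epsilon>. \<forall>\<mu>\<in>{0<..<\<mu>bar}. \<forall>t0.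
    \<forall>\<phi>0\<in>carrier_vec nphi. \<forall>z10\<in>carrier_vec l1. \<forall>z20\<in>ctl_X K. \<forall>m0.
    \<forall>r\<in>seqs q. \<forall>w\<in>seqs dy. \<forall>d\<^sub>\<Delta>\<in>seqs dy. \<forall>m :: int \<Rightarrow> real.
    \<forall>y\<in>seqs dy. \<forall>u\<in>seqs du. \<forall>z1 z2.
      perturbed_plant_eqs ny nu f \<theta> w d\<^sub>\<Delta> t0 \<phi>0 y u \<and>
      controller_eqs ny nu K t0 z10 z20 r y u z1 z2 \<and>
      m t0 = m0 \<and>
      (\<forall>t\<ge>t0. m (t + 1) = \<beta> * m t + \<beta> * \<bar>g (regressor ny nu y u t)\<bar>) \<and>
      (\<forall>t\<ge>t0. vnorm (d\<^sub>\<Delta> t) \<le> \<mu> * m t + \<mu> * \<bar>g (regressor ny nu y u t)\<bar>) \<longrightarrow>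
      (\<forall>t\<ge>t0.
        vnorm (regressor ny nu y u t @\<^sub>v z1 t @\<^sub>v vec_of_list [m t])
        \<le> c2 * lam2 powi (t - t0) * vnorm (\<phi>0 @\<^sub>v z10 @\<^sub>v vec_of_list [m0])
          + (\<Sum>j=t0..t - 1. c2 * lam2 powi (t - j - 1) * (vnorm (r j) + vnorm (w j)))
          + c2 * vnorm (r t))"
proof (intro ballI)
  fix \<beta> lam2 :: real
  assume "\<beta> \<in> {0<..<1}" "lam2 \<in> {max lam1 \<beta><..<1}"
  then have \<beta>: "0 < \<beta>" "\<beta> < lam2" and lam2: "lam1 < lam2" "lam2 < 1"
    by auto
  have c1: "1 \<le> c1" and lam1: "0 < lam1"
    using conv by (auto simp: convolution_bound_def)
  obtain \<nu> where \<nu>: "0 < \<nu>" "\<And>x. x \<in> carrier_vec nphi \<Longrightarrow> \<bar>g x\<bar> \<le> \<nu> * vnorm x"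
    using g by (auto simp: bounded_gain_def)
  define \<kappa> where "\<kappa> = (lam2 - lam1) / (2 * \<beta> * \<nu>)"
  \<comment> \<open>The two thresholds are those required of \<open>\<mu>\<close> in
    \<open>small_gain_bound\<close>. Like \<open>c2\<close>, they depend only on \<open>c1\<close>,
    \<open>lam1\<close>, \<open>lam2\<close>, \<open>\<beta>\<close> and \<open>\<nu>\<close>, so
    they can be fixed before any trajectory.\<close>
  define \<mu>bar where "\<mu>bar = min ((lam2 - lam1) / (2 * c1 * \<nu>)) (\<kappa> * (lam2 - \<beta>) / c1)"
  \<comment> \<open>Chosen to dominate all three final coefficients:
    \<open>(1 + 1 / \<kappa>) * (c1 + \<kappa>)\<close> of the initial state,
    \<open>(1 + 1 / \<kappa>) * (2 * c1)\<close> of the filtered input, and \<open>c1\<close> of the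
    feedthrough.\<close>
  define c2 where "c2 = (1 + 1 / \<kappa>) * (2 * c1 + \<kappa>)"
  have \<kappa>: "0 < \<kappa>"
    using \<beta> lam2 \<nu> by (simp add: \<kappa>_def)
  have \<mu>bar: "0 < \<mu>bar"
    using \<beta> lam2 \<nu> \<kappa> c1 by (simp add: \<mu>bar_def)
  have c2: "0 < c2" "c1 \<le> c2" "(1 + 1 / \<kappa>) * (c1 + \<kappa>) \<le> c2" "(1 + 1 / \<kappa>) * (2 * c1) \<le> c2"
    using \<kappa> c1 by (simp_all add: c2_def field_simps add_pos_pos)
  show "\<exists>\<mu>bar>0. \<exists>c2>0.
    \<forall>\<theta>\<in>slow_class p dy S c0 \<epsilon>. \<forall>\<mu>\<in>{0<..<\<mu>bar}. \<forall>t0.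
    \<forall>\<phi>0\<in>carrier_vec nphi. \<forall>z10\<in>carrier_vec l1. \<forall>z20\<in>ctl_X K. \<forall>m0.
    \<forall>r\<in>seqs q. \<forall>w\<in>seqs dy. \<forall>d\<^sub>\<Delta>\<in>seqs dy. \<forall>m :: int \<Rightarrow> real.
    \<forall>y\<in>seqs dy. \<forall>u\<in>seqs du. \<forall>z1 z2.
      perturbed_plant_eqs ny nu f \<theta> w d\<^sub>\<Delta> t0 \<phi>0 y u \<and>
      controller_eqs ny nu K t0 z10 z20 r y u z1 z2 \<and>
      m t0 = m0 \<and>
      (\<forall>t\<ge>t0. m (t + 1) = \<beta> * m t + \<beta> * \<bar>g (regressor ny nu y u t)\<bar>) \<and>
      (\<forall>t\<ge>t0. vnorm (d\<^sub>\<Delta> t) \<le> \<mu> * m t + \<mu> * \<bar>g (regressor ny nu y u t)\<bar>) \<longrightarrow>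
      (\<forall>t\<ge>t0.
        vnorm (regressor ny nu y u t @\<^sub>v z1 t @\<^sub>v vec_of_list [m t])
        \<le> c2 * lam2 powi (t - t0) * vnorm (\<phi>0 @\<^sub>v z10 @\<^sub>v vec_of_list [m0])
          + (\<Sum>j=t0..t - 1. c2 * lam2 powi (t - j - 1) * (vnorm (r j) + vnorm (w j)))
          + c2 * vnorm (r t))"
  proof (rule exI[of _ \<mu>bar], intro conjI \<mu>bar, rule exI[of _ c2], intro conjI c2(1) ballI allI impI)
    fix \<theta> \<mu> m0 and t0 t :: int and \<phi>0 z10 z20 :: "real vec"
      and r w d y u z1 z2 :: "int \<Rightarrow> real vec" and m :: "int \<Rightarrow> real"
    assume \<theta>: "\<theta> \<in> slow_class p dy S c0 \<epsilon>" and \<mu>: "\<mu> \<in> {0<..<\<mu>bar}"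
      and \<phi>0: "\<phi>0 \<in> carrier_vec nphi" and z10: "z10 \<in> carrier_vec l1" and z20: "z20 \<in> ctl_X K"
      and r: "r \<in> seqs q" and w: "w \<in> seqs dy" and d: "d \<in> seqs dy"
      and y: "y \<in> seqs dy" and u: "u \<in> seqs du" and t: "t0 \<le> t"
    let ?\<phi> = "regressor ny nu y u"
    assume "perturbed_plant_eqs ny nu f \<theta> w d t0 \<phi>0 y u \<and>
      controller_eqs ny nu K t0 z10 z20 r y u z1 z2 \<and>
      m t0 = m0 \<and>
      (\<forall>t\<ge>t0. m (t + 1) = \<beta> * m t + \<beta> * \<bar>g (?\<phi> t)\<bar>) \<and>
      (\<forall>t\<ge>t0. vnorm (d t) \<le> \<mu> * m t + \<mu> * \<bar>g (?\<phi> t)\<bar>)"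
    then have plant: "perturbed_plant_eqs ny nu f \<theta> w d t0 \<phi>0 y u"
      and ctl: "controller_eqs ny nu K t0 z10 z20 r y u z1 z2"
      and m0: "m t0 = m0"
      and m_step: "\<And>t. t0 \<le> t \<Longrightarrow> m (t + 1) = \<beta> * m t + \<beta> * \<bar>g (?\<phi> t)\<bar>"
      and d_le: "\<And>t. t0 \<le> t \<Longrightarrow> vnorm (d t) \<le> \<mu> * m t + \<mu> * \<bar>g (?\<phi> t)\<bar>"
      by blast+
    have start: "?\<phi> t0 = \<phi>0" "z1 t0 = z10"
      using plant ctl by (auto simp: perturbed_plant_eqs_def controller_eqs_def)
    have carrier: "\<theta> t \<in> carrier_mat p dy" "w t \<in> carrier_vec dy" "d t \<in> carrier_vec dy" for t
      using \<theta> w d by (auto simp: slow_class_def bounded_mat_seqs_def seqs_def)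
    \<comment> \<open>The convolution bound admits every disturbance sequence, hence also one such
      as \<open>w + d\<close> that may depend on the trajectory itself.\<close>
    have nominal: "plant_eqs ny nu f \<theta> (\<lambda>t. w t + d t) t0 \<phi>0 y u"
      unfolding plant_eqs_def
    proof (intro conjI allI impI)
      fix t assume "t0 \<le> t"
      then have "y (t + 1) = transpose_mat (\<theta> t) *\<^sub>v f (?\<phi> t) + w t + d t"
        using plant by (simp add: perturbed_plant_eqs_def)
      also have "\<dots> = transpose_mat (\<theta> t) *\<^sub>v f (?\<phi> t) + (w t + d t)"
        using carrier[of t] by (intro assoc_add_vec[of _ dy] carrier_vecI) auto
      finally show "y (t + 1) = transpose_mat (\<theta> t) *\<^sub>v f (?\<phi> t) + (w t + d t)" .
    qed (simp add: start)
    have wd: "(\<lambda>t. w t + d t) \<in> seqs dy"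
      using carrier by (simp add: seqs_def)
    define x where "x t = vnorm (?\<phi> t @\<^sub>v z1 t)" for t
    define a where "a t = vnorm (r t) + vnorm (w t)" for t
    define N0 where "N0 = vnorm (\<phi>0 @\<^sub>v z10 @\<^sub>v vec_of_list [m0])"
    have g_le: "\<bar>g (?\<phi> t)\<bar> \<le> \<nu> * x t" for t
    proof -
      have "\<bar>g (?\<phi> t)\<bar> \<le> \<nu> * vnorm (?\<phi> t)"
        using \<nu>(2) regressor_carrier[OF y u] nphi by simp
      also have "\<dots> \<le> \<nu> * x t"
        using \<nu>(1) vnorm_le_append_left by (simp add: x_def)
      finally show ?thesis .
    qed
    have x_le: "x t \<le> c1 * lam1 powi (t - t0) * vnorm (\<phi>0 @\<^sub>v z10)
        + c1 * filtered lam1 (\<lambda>j. a j + vnorm (d j)) t0 t + c1 * vnorm (r t)"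
      if t: "t0 \<le> t" for t
    proof -
      \<comment> \<open>The convolution bound is taken at \<open>\<tau> = t0\<close>.\<close>
      have "x t \<le> c1 * lam1 powi (t - t0) * x t0
          + (\<Sum>j=t0..t - 1. c1 * lam1 powi (t - j - 1) * (vnorm (r j) + vnorm (w j + d j)))
          + c1 * vnorm (r t)"
        using conv[unfolded convolution_bound_def] \<theta> \<phi>0 z10 z20 wd r y u nominal ctl t
        unfolding nphi x_def by blast
      also have "(\<Sum>j=t0..t - 1. c1 * lam1 powi (t - j - 1) * (vnorm (r j) + vnorm (w j + d j)))
          = c1 * filtered lam1 (\<lambda>j. vnorm (r j) + vnorm (w j + d j)) t0 t"
        by (simp add: filtered_def sum_distrib_left mult.assoc)
      \<comment> \<open>The triangle inequality separates the exogenous part \<open>a\<close> from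
        the feedback part \<open>vnorm (d j)\<close>.\<close>
      also have "\<dots> \<le> c1 * filtered lam1 (\<lambda>j. a j + vnorm (d j)) t0 t"
        using c1 lam1 vnorm_add_le[OF carrier(2,3)]
        by (intro mult_left_mono filtered_mono) (auto simp: a_def add.assoc)
      finally show ?thesis
        by (simp add: start x_def)
    qed
    have bound: "x t + \<bar>m t\<bar> \<le> (1 + 1 / \<kappa>) *
        (lam2 powi (t - t0) * (c1 * vnorm (\<phi>0 @\<^sub>v z10) + \<kappa> * \<bar>m t0\<bar>)
          + 2 * c1 * filtered lam2 a t0 t) + c1 * vnorm (r t)"
    \<comment> \<open>The initial value \<open>m0\<close> may be negative, so the nonnegative signal
      \<open>M\<close> is the absolute value of \<open>m\<close>. The input is \<open>a\<close>, and
      its part \<open>vnorm (r t)\<close> is the feedthrough \<open>\<rho>\<close>.\<close>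
    proof (rule small_gain_bound[where d = "\<lambda>t. vnorm (d t)" and M = "\<lambda>t. \<bar>m t\<bar>", OF lam1 lam2 \<beta> c1 \<nu>(1) \<kappa>_def])
      show "0 < \<mu>" "\<mu> \<le> (lam2 - lam1) / (2 * c1 * \<nu>)" "\<mu> \<le> \<kappa> * (lam2 - \<beta>) / c1"
        using \<mu> by (auto simp: \<mu>bar_def)
      show "\<bar>m (t + 1)\<bar> \<le> \<beta> * \<bar>m t\<bar> + \<beta> * \<nu> * x t" if "t0 \<le> t" for t
      proof -
        have "\<bar>m (t + 1)\<bar> \<le> \<beta> * \<bar>m t\<bar> + \<beta> * \<bar>g (?\<phi> t)\<bar>"
          unfolding m_step[OF that]
          using \<beta> abs_triangle_ineq[of "\<beta> * m t" "\<beta> * \<bar>g (?\<phi> t)\<bar>"] by (simp add: abs_mult)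
        also have "\<dots> \<le> \<beta> * \<bar>m t\<bar> + \<beta> * (\<nu> * x t)"
          using \<beta> g_le by simp
        finally show ?thesis by (simp add: mult.assoc)
      qed
      show "vnorm (d t) \<le> \<mu> * \<bar>m t\<bar> + \<mu> * \<nu> * x t" if "t0 \<le> t" for t
      proof -
        have "vnorm (d t) \<le> \<mu> * m t + \<mu> * \<bar>g (?\<phi> t)\<bar>"
          using d_le that .
        also have "\<dots> \<le> \<mu> * \<bar>m t\<bar> + \<mu> * (\<nu> * x t)"
          using \<mu> g_le by (intro add_mono mult_left_mono) auto
        finally show ?thesis by (simp add: mult.assoc)
      qed
    qed (use x_le t in \<open>auto simp: a_def\<close>)
    have N0: "vnorm (\<phi>0 @\<^sub>v z10) \<le> N0" "\<bar>m t0\<bar> \<le> N0"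
      using vnorm_le_append_left[of "\<phi>0 @\<^sub>v z10" "vec_of_list [m0]"]
        vnorm_le_append_right[of "vec_of_list [m0]" "\<phi>0 @\<^sub>v z10"]
      by (simp_all add: N0_def m0 flip: append_vec_assoc)
    have "vnorm (?\<phi> t @\<^sub>v z1 t @\<^sub>v vec_of_list [m t]) \<le> x t + \<bar>m t\<bar>"
      using vnorm_append_le[of "?\<phi> t @\<^sub>v z1 t" "vec_of_list [m t]"]
      by (simp add: x_def flip: append_vec_assoc)
    also note bound
    \<comment> \<open>Both initial terms are bounded by the norm \<open>N0\<close> of the full
      initial state, so that they merge into one term with factor
      \<open>c1 + \<kappa>\<close>.\<close>
    also have "(1 + 1 / \<kappa>) * (lam2 powi (t - t0) * (c1 * vnorm (\<phi>0 @\<^sub>v z10) + \<kappa> * \<bar>m t0\<bar>)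
          + 2 * c1 * filtered lam2 a t0 t) + c1 * vnorm (r t)
        \<le> (1 + 1 / \<kappa>) * (lam2 powi (t - t0) * (c1 * N0 + \<kappa> * N0)
          + 2 * c1 * filtered lam2 a t0 t) + c1 * vnorm (r t)"
      using N0 \<kappa> c1 lam1 lam2 by (intro add_mono mult_left_mono order_refl) auto
    also have "\<dots> = (1 + 1 / \<kappa>) * (c1 + \<kappa>) * (lam2 powi (t - t0) * N0)
        + (1 + 1 / \<kappa>) * (2 * c1) * filtered lam2 a t0 t + c1 * vnorm (r t)"
      by (simp only: distrib_left distrib_right mult_ac)
    also have "\<dots> \<le> c2 * (lam2 powi (t - t0) * N0) + c2 * filtered lam2 a t0 t + c2 * vnorm (r t)"
      using c2 lam1 lam2
      by (intro add_mono mult_right_mono filtered_nonneg) (auto simp: N0_def a_def)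
    finally show "vnorm (?\<phi> t @\<^sub>v z1 t @\<^sub>v vec_of_list [m t])
        \<le> c2 * lam2 powi (t - t0) * vnorm (\<phi>0 @\<^sub>v z10 @\<^sub>v vec_of_list [m0])
          + (\<Sum>j=t0..t - 1. c2 * lam2 powi (t - j - 1) * (vnorm (r j) + vnorm (w j)))
          + c2 * vnorm (r t)"
      by (simp add: filtered_def N0_def a_def sum_distrib_left mult.assoc)
  qed
qed

end
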